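(* Let $d=3$, $N=2^d=8$, $\alpha=5/2$, and consider the tree dyadic model with repeated coefficients $\{\delta_\omega:\omega\in\Omega\}$ (RCM). Then there exists a unique constant finite-energy solution $u=(u_j)_{j\in J}$. The exponents of the structure function corresponding to this solution are given by $$\zeta_p=\frac p3+\frac p2\bigl(\ell_{3/2}-\ell_{p/2}\bigr),\qquad p\ge 0,$$ where $\ell_s$ is a function of $s$ that depends on the repeated coefficients $\delta_\omega$: it is constant if they are all equal, while otherwise it is strictly increasing with finite limits at $\pm\infty$. In the latter case, the function $\zeta_p$ is strictly concave and has an oblique asymptote. Moreover, if the ratio between the maximum of the $\delta_\omega^{3/2}$, $\omega\in\Omega$, and their average $\frac1N\sum_\omega\delta_\omega^{3/2}$ is less than $2$, then $\zeta_p$ is increasing for all $p$.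
   Context: Tree: $J=\bigcup_{n\ge0}\{1,\dots,N\}^n$ is the set of finite words, $\emptyset$ the empty word, $|j|$ the length of $j$; for $j\neq\emptyset$, $\bar\jmath$ is $j$ with its last letter removed; $\mathcal O_j=\{k\in J:\bar k=j\}$. Model: given $\alpha>0$, $f>0$ and positive coefficients $(d_j)_{j\in J}$ with $d_\emptyset=1$, let $c_j=d_j2^{\alpha|j|}$ and consider $$v_j'(t)=c_jv_{\bar\jmath}^2(t)-\sum_{k\in\mathcal O_j}c_kv_j(t)v_k(t),\qquad j\in J,\ t\ge0,$$ with the convention $v_{\bar\emptyset}(t)\equiv f$. A constant (componentwise) solution is a family $u=(u_j)_{j\in J}$ of non-negative reals with $c_ju_{\bar\jmath}^2=\sum_{k\in\mathcal O_j}c_ku_ju_k$ for all $j\in J$ (with $u_{\bar\emptyset}=f$). It has finite energy (is a Leray solution) if $\sum_{j\in J}u_j^2<\infty$. Repeated coefficients model (RCM): there is a family $\{\delta_\omega:\omega\in\Omega\}$ of positive numbers, $|\Omega|=N$, such that for every $j\in J$ the set $\{d_k:k\in\mathcal O_j\}$, considered with multiplicities, equals $\{\delta_\omega:\omega\in\Omega\}$. Notation: $\ell_s=\frac1s\log_2\bigl(\frac1N\sum_{\omega}\delta_\omega^s\bigr)$ for $s\in\mathbb R\setminus\{0\}$ and $\ell_0=\frac1N\sum_\omega\log_2\delta_\omega$. Exponents of the structure function of $u$, in terms of the coefficients $u_j$: $$\zeta_p=\min\Bigl\{p\,;\ d-\frac p2d-\limsup_{n\to\infty}\frac1n\log_2\sum_{|j|=n}|u_j|^p\Bigr\},\qquad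 p\ge0.$$
   Formalization: The cap min{p; ·} can bind, so ζ_p is shown to be min{p; formula}; the formula for all p and strict concavity of ζ_p are claimed if ℓ_{3/2} − ℓ_0 ≤ 4/3. The asymptote always exists for unequal δ_ω, but its slope is claimed nonzero only if the max/average ratio is not 2. *)

theory Defs
  imports "HOL-Analysis.Analysis" "HOL-Library.Multiset"
begin

text \<open>
  Words over the alphabet \<open>{1..N}\<close> are lists with the first letter at the head, so that removing
  the last letter is \<^const>\<open>butlast\<close>.
\<close>

definition words :: "nat \<Rightarrow> nat list set" where
  "words N = lists {1..N}"

definition level :: "nat \<Rightarrow> nat \<Rightarrow> nat list set" where
  "level N n = {j \<in> words N. length j = n}"

text \<open>
  The guard \<open>k \<noteq> []\<close> is needed because \<open>butlast [] = []\<close>, whereas the root is nobody's child.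
\<close>

definition children :: "nat \<Rightarrow> nat list \<Rightarrow> nat list set" where
  "children N j = {k \<in> words N. k \<noteq> [] \<and> butlast k = j}"

definition coeff_c :: "real \<Rightarrow> (nat list \<Rightarrow> real) \<Rightarrow> nat list \<Rightarrow> real" where
  "coeff_c \<alpha> d j = d j * 2 powr (\<alpha> * real (length j))"

definition parent_value :: "real \<Rightarrow> (nat list \<Rightarrow> real) \<Rightarrow> nat list \<Rightarrow> real" where
  "parent_value f u j = (if j = [] then f else u (butlast j))"

text \<open>
  A family indexed by the tree is an extensional function on \<open>words N\<close>, so that uniqueness of the
  family is uniqueness of the function.
\<close>

definition constant_solution ::
  "nat \<Rightarrow> real \<Rightarrow> real \<Rightarrow> (nat list \<Rightarrow> real) \<Rightarrow> (nat list \<Rightarrow> real) \<Rightarrow> bool" where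
  "constant_solution N \<alpha> f d u \<longleftrightarrow>
     u \<in> words N \<rightarrow>\<^sub>E {0..} \<and>
     (\<forall>j\<in>words N. coeff_c \<alpha> d j * (parent_value f u j)\<^sup>2
        = (\<Sum>k\<in>children N j. coeff_c \<alpha> d k * u j * u k))"

definition finite_energy :: "nat \<Rightarrow> (nat list \<Rightarrow> real) \<Rightarrow> bool" where
  "finite_energy N u \<longleftrightarrow> (\<lambda>j. (u j)\<^sup>2) summable_on words N"

definition repeated_coefficients ::
  "nat \<Rightarrow> (nat list \<Rightarrow> real) \<Rightarrow> 'w set \<Rightarrow> ('w \<Rightarrow> real) \<Rightarrow> bool" where
  "repeated_coefficients N d \<Omega> \<delta> \<longleftrightarrow>
     finite \<Omega> \<and> card \<Omega> = N \<and> (\<forall>\<omega>\<in>\<Omega>. 0 < \<delta> \<omega>) \<and>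
     (\<forall>j\<in>words N. image_mset d (mset_set (children N j)) = image_mset \<delta> (mset_set \<Omega>))"

definition ell :: "'w set \<Rightarrow> ('w \<Rightarrow> real) \<Rightarrow> real \<Rightarrow> real" where
  "ell \<Omega> \<delta> s =
     (if s = 0 then (\<Sum>\<omega>\<in>\<Omega>. log 2 (\<delta> \<omega>)) / real (card \<Omega>)
      else 1 / s * log 2 ((\<Sum>\<omega>\<in>\<Omega>. \<delta> \<omega> powr s) / real (card \<Omega>)))"

text \<open>
  The upper limit is taken in the extended reals. Constant solutions with \<open>f > 0\<close> are strictly
  positive, so the conventions \<open>log 2 0 = 0\<close> and \<open>0 powr 0 = 0\<close> play no role for them.
\<close>

definition structure_exponent :: "nat \<Rightarrow> nat \<Rightarrow> (nat list \<Rightarrow> real) \<Rightarrow> real \<Rightarrow> ereal" where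
  "structure_exponent dm N u p =
     min (ereal p)
         (ereal (real dm - p / 2 * real dm)
          - limsup (\<lambda>n. ereal (1 / real n * log 2 (\<Sum>j\<in>level N n. \<bar>u j\<bar> powr p))))"

definition strictly_concave_on :: "real set \<Rightarrow> (real \<Rightarrow> real) \<Rightarrow> bool" where
  "strictly_concave_on S g \<longleftrightarrow>
     convex S \<and>
     (\<forall>x\<in>S. \<forall>y\<in>S. \<forall>t\<in>{0<..<1}. x \<noteq> y \<longrightarrow>
        (1 - t) * g x + t * g y < g ((1 - t) * x + t * y))"

end

theory Submission
  imports Defs "HOL-Real_Asymp.Real_Asymp"
begin

text \<open>
  Put \<open>q\<^sub>j = u\<^sub>j / u\<close>(parent of \<open>j\<close>). The equation at \<open>j\<close> becomes
  \<open>d\<^sub>j / q\<^sub>j\<^sup>2 = 2 powr \<alpha> * (\<Sum>k. d\<^sub>k * q\<^sub>k)\<close>, the sum being over the children of \<open>j\<close>, and under repeated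
  coefficients it is solved by \<open>q\<^sub>j = y * sqrt d\<^sub>j\<close> with
  \<open>y\<^sup>3 * 2 powr \<alpha> * (\<Sum>\<omega>. \<delta>\<^sub>\<omega> powr (3 / 2)) = 1\<close>. For any other solution write \<open>q\<^sub>j = s\<^sub>j * y * sqrt d\<^sub>j\<close>; then
  \<open>1 / s\<^sub>j\<^sup>2\<close> is a weighted mean of the \<open>s\<^sub>k\<close> over the children, so a value \<open>s\<^sub>j \<noteq> 1\<close> is amplified along
  some branch of the tree, on which the logarithm of \<open>u\<close> grows exponentially. This contradicts
  finite energy. The sums of \<open>u powr p\<close> over the levels of the remaining solution are geometric, and
  they express \<open>\<zeta>\<^sub>p\<close> through power means of \<open>\<delta>\<close>, whose properties follow from strict convexity of
  \<open>log 2 (\<Sum>\<omega>. \<delta>\<^sub>\<omega> powr s)\<close> in \<open>s\<close>.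
\<close>

section \<open>Power sums and power means\<close>

lemma ln_less_minus_one:
  fixes x :: real
  assumes "0 < x" "x \<noteq> 1"
  shows "ln x < x - 1"
  using ln_le_minus_one[of x] ln_eq_minus_one[of x] assms by linarith

text \<open>Apply \<open>ln z <= z - 1\<close> to \<open>a / c\<close> and \<open>b / c\<close>,
  where \<open>c\<close> is the weighted mean: the linear bounds cancel in the weighted sum, and the
  first one is strict because \<open>a\<close> differs from \<open>c\<close>.\<close>

lemma ln_strict_concave_two:
  fixes a b t :: real
  assumes "0 < a" "0 < b" "a \<noteq> b" "0 < t" "t < 1"
  shows "(1 - t) * ln a + t * ln b < ln ((1 - t) * a + t * b)"
proof -
  define c where "c = (1 - t) * a + t * b"
  have c: "c > 0"
    unfolding c_def using assms by (intro add_pos_pos mult_pos_pos) auto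
  have ac: "a \<noteq> c"
  proof
    assume "a = c"
    then have "t * (b - a) = 0" by (simp add: c_def right_diff_distrib left_diff_distrib)
    then show False using assms by simp
  qed
  have lt: "ln (a / c) < a / c - 1"
    using assms c ac by (intro ln_less_minus_one) auto
  have le: "ln (b / c) \<le> b / c - 1"
    using ln_le_minus_one[of "b / c"] assms c by simp
  have "(1 - t) * ln (a / c) + t * ln (b / c) < (1 - t) * (a / c - 1) + t * (b / c - 1)"
    using lt le assms by (intro add_less_le_mono mult_strict_left_mono mult_left_mono) auto
  also have "\<dots> = ((1 - t) * a + t * b) / c - 1"
    by (simp add: add_divide_distrib right_diff_distrib)
  also have "\<dots> = 0" using c by (simp add: c_def)
  finally show ?thesis
    unfolding c_def[symmetric] using assms c by (simp add: ln_div algebra_simps)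
qed

lemma weighted_am_gm_strict:
  fixes a b t :: real
  assumes "0 < a" "0 < b" "a \<noteq> b" "0 < t" "t < 1"
  shows "a powr (1 - t) * b powr t < (1 - t) * a + t * b"
proof -
  have "a powr (1 - t) * b powr t = exp ((1 - t) * ln a + t * ln b)"
    using assms by (simp add: powr_def exp_add)
  also have "\<dots> < exp (ln ((1 - t) * a + t * b))"
    using ln_strict_concave_two[OF assms] by simp
  also have "\<dots> = (1 - t) * a + t * b"
    using assms by (intro exp_ln add_pos_pos mult_pos_pos) auto
  finally show ?thesis .
qed

section \<open>Power sums of a positive family\<close>

definition power_sum :: "'a set \<Rightarrow> ('a \<Rightarrow> real) \<Rightarrow> real \<Rightarrow> real" where
  "power_sum A x s = (\<Sum>w\<in>A. x w powr s)"

text \<open>The family is left abstract because the results are applied to the reciprocals as well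
  as to the coefficients \<open>\<delta>\<close>.\<close>

locale positive_family =
  fixes A :: "'a set" and x :: "'a \<Rightarrow> real"
  assumes finite_A: "finite A" and A_nonempty: "A \<noteq> {}" and x_pos: "w \<in> A \<Longrightarrow> 0 < x w"
begin

abbreviation "S \<equiv> power_sum A x"
abbreviation "L \<equiv> ell A x"
abbreviation "M \<equiv> Max (x ` A)"

lemma card_pos: "0 < real (card A)"
  using finite_A A_nonempty by (simp add: card_gt_0_iff)

lemma S_pos: "0 < S s"
  unfolding power_sum_def using finite_A A_nonempty x_pos by (intro sum_pos) (auto simp: less_le)

lemma S_zero: "S 0 = real (card A)"
  unfolding power_sum_def using x_pos by (simp add: less_imp_neq[symmetric])

text \<open>One identity for all \<open>s\<close>, with no case split at 0: \<open>s * L s\<close>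
  is \<open>log 2 (S s)\<close> shifted to vanish at 0, so convexity and asymptotics of the power
  sums pass to \<open>L\<close>.\<close>

lemma log_S_eq: "log 2 (S s) = log 2 (real (card A)) + s * L s"
proof (cases "s = 0")
  case True
  then show ?thesis by (simp add: S_zero)
next
  case False
  have "s * L s = log 2 (S s / real (card A))"
    using False by (simp add: ell_def power_sum_def)
  then show ?thesis
    using S_pos[of s] card_pos by (simp add: log_divide)
qed

lemma x_le_M: "w \<in> A \<Longrightarrow> x w \<le> M"
  using finite_A by simp

lemma M_attained: obtains w where "w \<in> A" "x w = M"
proof -
  have "M \<in> x ` A"
    using finite_A A_nonempty by (intro Max_in) auto
  then show thesis using that by auto
qed

lemma M_pos: "0 < M"
  by (rule M_attained) (use x_pos in force)

lemma Max_powr_eq: "0 \<le> s \<Longrightarrow> Max ((\<lambda>w. x w powr s) ` A) = M powr s"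
proof (rule Max_eqI)
  show "finite ((\<lambda>w. x w powr s) ` A)" using finite_A by simp
  show "y \<le> M powr s" if "0 \<le> s" "y \<in> (\<lambda>w. x w powr s) ` A" for y
    using that x_le_M x_pos by (auto intro!: powr_mono2 simp: less_imp_le)
  obtain w where "w \<in> A" "x w = M" by (rule M_attained)
  then show "M powr s \<in> (\<lambda>w. x w powr s) ` A"
    by (intro image_eqI[of _ _ w]) auto
qed

text \<open>Split \<open>x w powr t\<close> as \<open>x w powr (t - s) * x w powr s\<close> and
  bound the first factor by its value at the maximum. In logarithms, \<open>log 2 (S s)\<close> has
  slope at most \<open>log 2 M\<close>.\<close>

lemma S_growth_le:
  assumes "s \<le> t"
  shows "S t \<le> M powr (t - s) * S s"
  unfolding power_sum_def sum_distrib_left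
proof (rule sum_mono)
  fix w assume w: "w \<in> A"
  have "x w powr t = x w powr (t - s) * x w powr s"
    using x_pos[OF w] by (simp flip: powr_add)
  also have "\<dots> \<le> M powr (t - s) * x w powr s"
    using assms x_pos[OF w] x_le_M[OF w] by (intro mult_right_mono powr_mono2) auto
  finally show "x w powr t \<le> M powr (t - s) * x w powr s" .
qed

lemma log_S_growth_le:
  assumes "s \<le> t"
  shows "log 2 (S t) - log 2 (S s) \<le> (t - s) * log 2 M"
proof -
  have "log 2 (S t) \<le> log 2 (M powr (t - s) * S s)"
    using S_growth_le[OF assms] S_pos[of s] S_pos[of t] M_pos by simp
  also have "\<dots> = (t - s) * log 2 M + log 2 (S s)"
    using M_pos S_pos[of s] by (simp add: log_mult log_powr)
  finally show ?thesis by simp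
qed

lemma M_powr_le_S: "M powr s \<le> S s"
proof -
  obtain w where w: "w \<in> A" "x w = M" by (rule M_attained)
  show ?thesis
    unfolding power_sum_def
    using member_le_sum[of w A "\<lambda>w. x w powr s"] w finite_A by simp
qed

lemma L_const:
  assumes "\<forall>w\<in>A. \<forall>w'\<in>A. x w = x w'"
  shows "L s = log 2 M"
proof -
  obtain w0 where "w0 \<in> A" "x w0 = M" by (rule M_attained)
  then have eq: "x w = M" if "w \<in> A" for w
    using assms that by metis
  have "(\<Sum>w\<in>A. x w powr s) = real (card A) * M powr s"
    "(\<Sum>w\<in>A. log 2 (x w)) = real (card A) * log 2 M"
    using eq by simp_all
  then show ?thesis
    using card_pos M_pos by (simp add: ell_def log_powr)
qed

section \<open>Strict convexity in the exponent and monotonicity of power means\<close>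

text \<open>This is Hoelder's inequality with its equality case. Both families of powers are
  normalised to total 1 and compared term by term by AM-GM; equality in every term would make the
  family constant.\<close>

lemma log_S_strict_convex:
  assumes nonconst: "\<not> (\<forall>w\<in>A. \<forall>w'\<in>A. x w = x w')"
    and "s \<noteq> t" "0 < \<theta>" "\<theta> < 1"
  shows "log 2 (S ((1 - \<theta>) * s + \<theta> * t)) < (1 - \<theta>) * log 2 (S s) + \<theta> * log 2 (S t)"
proof -
  define a where "a w = x w powr s / S s" for w
  define b where "b w = x w powr t / S t" for w
  have pos: "0 < a w" "0 < b w" if "w \<in> A" for w
    using x_pos[OF that] S_pos by (auto simp: a_def b_def)
  have total: "(\<Sum>w\<in>A. a w) = 1" "(\<Sum>w\<in>A. b w) = 1"
    unfolding a_def b_def sum_divide_distrib[symmetric] power_sum_def[symmetric]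
    using S_pos by (simp_all add: less_imp_neq[symmetric])
  have "\<exists>w\<in>A. a w \<noteq> b w"
  proof (rule ccontr)
    assume "\<not> ?thesis"
    then have eq: "x w powr s / S s = x w powr t / S t" if "w \<in> A" for w
      using that by (simp add: a_def b_def)
    \<comment> \<open>Solving for \<open>x w\<close> gives a value that does not depend on
      \<open>w\<close>.\<close>
    have *: "x w = (S s / S t) powr (1 / (s - t))" if "w \<in> A" for w
    proof -
      have "x w powr (s - t) = S s / S t"
        using eq[OF that] S_pos[of s] S_pos[of t] x_pos[OF that]
        by (simp add: powr_diff field_simps)
      then have "(S s / S t) powr (1 / (s - t)) = x w powr ((s - t) * (1 / (s - t)))"
        by (simp add: powr_powr flip: \<open>x w powr (s - t) = S s / S t\<close>)
      then show ?thesis using assms(2) x_pos[OF that] by simp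
    qed
    show False using nonconst * by metis
  qed
  then obtain w0 where w0: "w0 \<in> A" "a w0 \<noteq> b w0" by blast
  have "(\<Sum>w\<in>A. a w powr (1 - \<theta>) * b w powr \<theta>) < (\<Sum>w\<in>A. (1 - \<theta>) * a w + \<theta> * b w)"
  proof (rule sum_strict_mono_ex1[OF finite_A])
    show "\<forall>w\<in>A. a w powr (1 - \<theta>) * b w powr \<theta> \<le> (1 - \<theta>) * a w + \<theta> * b w"
    proof
      fix w assume w: "w \<in> A"
      show "a w powr (1 - \<theta>) * b w powr \<theta> \<le> (1 - \<theta>) * a w + \<theta> * b w"
      proof (cases "a w = b w")
        case True
        then show ?thesis using pos[OF w] by (simp add: algebra_simps flip: powr_add)
      next
        case False
        then show ?thesis using weighted_am_gm_strict[of "a w" "b w" \<theta>] pos[OF w] assms by simp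
      qed
    qed
    show "\<exists>w\<in>A. a w powr (1 - \<theta>) * b w powr \<theta> < (1 - \<theta>) * a w + \<theta> * b w"
      using weighted_am_gm_strict[of "a w0" "b w0" \<theta>] pos[OF w0(1)] w0 assms by auto
  qed
  also have "\<dots> = 1"
    by (simp add: sum.distrib total flip: sum_distrib_left)
  also have "(\<Sum>w\<in>A. a w powr (1 - \<theta>) * b w powr \<theta>) =
      S ((1 - \<theta>) * s + \<theta> * t) / (S s powr (1 - \<theta>) * S t powr \<theta>)"
    unfolding power_sum_def[of A x "(1 - \<theta>) * s + \<theta> * t"] sum_divide_distrib
    by (intro sum.cong) (simp_all add: a_def b_def powr_divide powr_powr powr_add mult.commute)
  finally have "S ((1 - \<theta>) * s + \<theta> * t) < S s powr (1 - \<theta>) * S t powr \<theta>"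
    using S_pos[of s] S_pos[of t] by (simp add: divide_less_eq)
  then have "log 2 (S ((1 - \<theta>) * s + \<theta> * t)) < log 2 (S s powr (1 - \<theta>) * S t powr \<theta>)"
    using S_pos[of "(1 - \<theta>) * s + \<theta> * t"] S_pos[of s] S_pos[of t] by simp
  also have "\<dots> = (1 - \<theta>) * log 2 (S s) + \<theta> * log 2 (S t)"
    using S_pos[of s] S_pos[of t] by (simp add: log_mult log_powr)
  finally show ?thesis .
qed

text \<open>Jensen's inequality for the logarithm, between geometric mean and power mean. The factor
  \<open>s\<close> treats both signs at once: after division by it the inequality reverses for
  negative \<open>s\<close>.\<close>

lemma mult_L_zero_less:
  assumes nonconst: "\<not> (\<forall>w\<in>A. \<forall>w'\<in>A. x w = x w')" and "s \<noteq> 0"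
  shows "s * L 0 < s * L s"
proof -
  \<comment> \<open>Dividing by the mean makes the sum of the bounds \<open>z - 1\<close>
    vanish.\<close>
  define m where "m = S s / real (card A)"
  have m: "0 < m" using S_pos card_pos by (simp add: m_def)
  have "\<exists>w\<in>A. x w powr s \<noteq> m"
  proof (rule ccontr)
    assume "\<not> ?thesis"
    then have "x w powr s = m" if "w \<in> A" for w
      using that by blast
    then have "(x w powr s) powr (1 / s) = m powr (1 / s)" if "w \<in> A" for w
      using that by metis
    then have "x w = m powr (1 / s)" if "w \<in> A" for w
      using that assms(2) x_pos[OF that] by (simp add: powr_powr abs_of_pos[OF x_pos])
    then show False using nonconst by metis
  qed
  then obtain w0 where w0: "w0 \<in> A" "x w0 powr s \<noteq> m" by blast
  have strict: "ln (x w powr s / m) < x w powr s / m - 1" if "w \<in> A" "x w powr s \<noteq> m" for w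
    using x_pos[OF that(1)] m that(2) by (intro ln_less_minus_one) auto
  have "(\<Sum>w\<in>A. ln (x w powr s / m)) < (\<Sum>w\<in>A. x w powr s / m - 1)"
  proof (rule sum_strict_mono_ex1[OF finite_A])
    show "\<forall>w\<in>A. ln (x w powr s / m) \<le> x w powr s / m - 1"
      using x_pos m by (auto intro!: ln_le_minus_one divide_pos_pos simp: less_imp_neq[symmetric])
    show "\<exists>w\<in>A. ln (x w powr s / m) < x w powr s / m - 1"
      using strict w0 by blast
  qed
  also have "\<dots> = S s / m - real (card A)"
    by (simp add: sum_subtractf power_sum_def sum_divide_distrib)
  also have "\<dots> = 0"
    using S_pos[of s] card_pos by (simp add: m_def)
  also have "(\<Sum>w\<in>A. ln (x w powr s / m)) = (\<Sum>w\<in>A. s * ln (x w) - ln m)"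
    using x_pos m by (intro sum.cong) (auto simp: ln_div ln_powr less_imp_neq[symmetric])
  also have "\<dots> = s * (\<Sum>w\<in>A. ln (x w)) - real (card A) * ln m"
    by (simp add: sum_subtractf sum_distrib_left)
  finally have "s * ((\<Sum>w\<in>A. ln (x w)) / real (card A)) < ln m"
    using card_pos by (simp add: field_simps)
  then have "s * ((\<Sum>w\<in>A. ln (x w)) / real (card A)) / ln 2 < ln m / ln 2"
    by (intro divide_strict_right_mono) auto
  moreover have "L 0 = (\<Sum>w\<in>A. ln (x w)) / real (card A) / ln 2"
    by (simp add: ell_def log_def sum_divide_distrib mult.commute)
  moreover have "s * L s = ln m / ln 2"
    using assms(2) by (simp add: ell_def m_def power_sum_def log_def)
  ultimately show ?thesis by simp
qed

text \<open>The function \<open>s * L s\<close> is strictly convex and vanishes at 0, and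
  \<open>L s\<close> is the slope of its chord from the origin, so it increases on each side of 0.
  The two sides are joined through \<open>L 0\<close>, where \<open>ell\<close> is defined
  separately.\<close>

lemma L_strict_mono:
  assumes nonconst: "\<not> (\<forall>w\<in>A. \<forall>w'\<in>A. x w = x w')"
  shows "strict_mono L"
proof -
  \<comment> \<open>Strict convexity on the segment from 0 to \<open>s\<close>.\<close>
  have scaled: "\<theta> * s * L (\<theta> * s) < \<theta> * (s * L s)" if "s \<noteq> 0" "0 < \<theta>" "\<theta> < 1" for s \<theta>
  proof -
    have "log 2 (S (\<theta> * s)) < (1 - \<theta>) * log 2 (S 0) + \<theta> * log 2 (S s)"
      using log_S_strict_convex[OF nonconst, of 0 s \<theta>] that by simp
    then show ?thesis
      by (simp add: log_S_eq algebra_simps)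
  qed
  have zero_less: "L 0 < L s" if "0 < s" for s
    using mult_L_zero_less[OF nonconst, of s] that by simp
  have less_zero: "L s < L 0" if "s < 0" for s
    using mult_L_zero_less[OF nonconst, of s] that by simp
  have pos: "L s < L t" if "0 < s" "s < t" for s t
  proof -
    have "s * L s < s * L t"
      using scaled[of t "s / t"] that by simp
    then show ?thesis using that by simp
  qed
  have neg: "L s < L t" if "t < 0" "s < t" for s t
  proof -
    have "t * L t < t * L s"
      using scaled[of s "t / s"] that by (simp add: divide_neg_neg)
    then show ?thesis using that by simp
  qed
  show ?thesis
  proof (rule strict_monoI)
    fix s t :: real assume st: "s < t"
    consider "0 < s" | "s = 0" | "s < 0" "0 < t" | "s < 0" "t = 0" | "t < 0"
      using st by linarith
    then show "L s < L t"
      using pos[of s t] neg[of t s] zero_less[of t] less_zero[of s] st by cases auto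
  qed
qed

lemma L_mono: "mono L"
proof (cases "\<forall>w\<in>A. \<forall>w'\<in>A. x w = x w'")
  case True
  show ?thesis by (rule monoI) (simp add: L_const[OF True])
next
  case False
  then show ?thesis using L_strict_mono strict_mono_mono by blast
qed

section \<open>Behaviour for large positive and negative exponents\<close>

text \<open>\<open>S s\<close> lies between \<open>M powr s\<close> and \<open>card A\<close> times
  it, and the logarithm of the constant is negligible after division by \<open>s\<close>.\<close>

lemma L_at_top: "(L \<longlongrightarrow> log 2 M) at_top"
proof (rule tendsto_sandwich)
  have eq: "L s = (log 2 (S s) - log 2 (real (card A))) / s" if "s > 0" for s
    using log_S_eq[of s] that by (simp add: field_simps)
  show "\<forall>\<^sub>F s in at_top. log 2 M - log 2 (real (card A)) / s \<le> L s"
    using eventually_gt_at_top[of 0]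
  proof eventually_elim
    case (elim s)
    have "log 2 (M powr s) \<le> log 2 (S s)"
      using M_powr_le_S[of s] M_pos S_pos[of s] by simp
    then have "s * log 2 M - log 2 (real (card A)) \<le> log 2 (S s) - log 2 (real (card A))"
      by (simp add: log_powr)
    then have "(s * log 2 M - log 2 (real (card A))) / s \<le> L s"
      unfolding eq[OF elim] using elim by (intro divide_right_mono) auto
    then show ?case using elim by (simp add: diff_divide_distrib)
  qed
  show "\<forall>\<^sub>F s in at_top. L s \<le> log 2 M"
    using eventually_gt_at_top[of 0]
  proof eventually_elim
    case (elim s)
    show ?case
      using log_S_growth_le[of 0 s] elim by (simp add: log_S_eq)
  qed
  have "((\<lambda>s. a - b / s) \<longlongrightarrow> a) at_top" for a b :: real
    by real_asymp
  then show "((\<lambda>s. log 2 M - log 2 (real (card A)) / s) \<longlongrightarrow> log 2 M) at_top" .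
qed simp

text \<open>In \<open>S s / M powr s\<close> each maximiser contributes 1 and every other term
  decays to 0, so the limit is the multiplicity of the maximum.\<close>

lemma log_S_asymptote:
  "((\<lambda>s. log 2 (S s) - (s * log 2 M + log 2 (real (card {w \<in> A. x w = M})))) \<longlongrightarrow> 0) at_top"
proof -
  define m where "m = real (card {w \<in> A. x w = M})"
  obtain w where "w \<in> A" "x w = M" by (rule M_attained)
  then have "{w \<in> A. x w = M} \<noteq> {}" by auto
  then have m: "0 < m" using finite_A by (simp add: m_def card_gt_0_iff)
  have "((\<lambda>s. (x w / M) powr s) \<longlongrightarrow> (if x w = M then 1 else 0)) at_top" if "w \<in> A" for w
  proof (cases "x w = M")
    case True
    then show ?thesis using M_pos by simp
  next
    case False
    then have "x w / M < 1" "0 < x w / M"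
      using x_le_M[OF that] x_pos[OF that] M_pos by auto
    have "((\<lambda>s. q powr s) \<longlongrightarrow> 0) at_top" if "q < 1" "0 < q" for q :: real
      using that by real_asymp
    from this[OF \<open>x w / M < 1\<close> \<open>0 < x w / M\<close>]
    have "((\<lambda>s. (x w / M) powr s) \<longlongrightarrow> 0) at_top" .
    then show ?thesis using False by simp
  qed
  then have "((\<lambda>s. \<Sum>w\<in>A. (x w / M) powr s) \<longlongrightarrow> (\<Sum>w\<in>A. if x w = M then 1 else 0)) at_top"
    by (intro tendsto_sum) auto
  also have "(\<Sum>w\<in>A. if x w = M then 1 else 0) = m"
    using finite_A by (simp add: m_def sum.If_cases Int_def)
  also have "(\<lambda>s. \<Sum>w\<in>A. (x w / M) powr s) = (\<lambda>s. S s / M powr s)"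
    using M_pos x_pos by (auto simp: power_sum_def sum_divide_distrib powr_divide less_imp_le
        intro!: sum.cong)
  finally have "((\<lambda>s. log 2 (S s / M powr s)) \<longlongrightarrow> log 2 m) at_top"
    using m by (intro tendsto_log) auto
  then have "((\<lambda>s. log 2 (S s / M powr s) - log 2 m) \<longlongrightarrow> log 2 m - log 2 m) at_top"
    by (intro tendsto_diff tendsto_const)
  moreover have "log 2 (S s / M powr s) = log 2 (S s) - s * log 2 M" for s
    using S_pos[of s] M_pos by (simp add: log_divide log_powr)
  ultimately show ?thesis
    by (simp add: m_def diff_diff_eq)
qed

end

lemma (in positive_family) positive_family_inverse: "positive_family A (\<lambda>w. inverse (x w))"
  using finite_A A_nonempty x_pos by unfold_locales auto

text \<open>Reduces the limit at minus infinity to the limit at plus infinity for the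
  reciprocals.\<close>

lemma (in positive_family) L_uminus: "L (- s) = - ell A (\<lambda>w. inverse (x w)) s"
  using x_pos
  by (auto simp: ell_def log_inverse powr_minus inverse_powr sum_negf)

lemma (in positive_family) L_at_bot: "\<exists>b. (L \<longlongrightarrow> b) at_bot"
proof -
  interpret inv: positive_family A "\<lambda>w. inverse (x w)" by (rule positive_family_inverse)
  show ?thesis
    unfolding filterlim_at_bot_mirror L_uminus using inv.L_at_top by (blast intro: tendsto_minus)
qed

section \<open>Constant solutions on the tree\<close>

lemma children_eq: "j \<in> words N \<Longrightarrow> children N j = (\<lambda>a. j @ [a]) ` {1..N}"
proof (intro equalityI subsetI)
  fix k assume j: "j \<in> words N" and "k \<in> children N j"
  then have k: "set k \<subseteq> {1..N}" "k \<noteq> []" "butlast k = j"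
    by (auto simp: children_def words_def)
  have "k = j @ [last k]" using append_butlast_last_id[OF k(2)] k(3) by simp
  moreover have "last k \<in> {1..N}" using last_in_set[OF k(2)] k(1) by blast
  ultimately show "k \<in> (\<lambda>a. j @ [a]) ` {1..N}" by blast
qed (auto simp: children_def words_def)

lemma Nil_in_words: "[] \<in> words N"
  by (simp add: words_def)

lemma children_subset_words: "children N j \<subseteq> words N"
  by (auto simp: children_def)

lemma words_induct [consumes 1, case_names Nil child]:
  assumes "j \<in> words N" "P []"
    and step: "\<And>j k. j \<in> words N \<Longrightarrow> k \<in> children N j \<Longrightarrow> P j \<Longrightarrow> P k"
  shows "P j"
  using assms(1)
proof (induction j rule: rev_induct)
  case (snoc a j)
  then have "j \<in> words N" "j @ [a] \<in> children N j" by (auto simp: words_def children_def)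
  then show ?case using step snoc.IH by blast
qed (rule assms(2))

lemma level_0: "level N 0 = {[]}"
  by (auto simp: level_def words_def)

lemma level_Suc: "level N (Suc n) = (\<Union>j\<in>level N n. children N j)"
proof (intro equalityI subsetI)
  fix k assume "k \<in> level N (Suc n)"
  then have "k \<in> children N (butlast k)" "butlast k \<in> level N n"
    by (auto simp: level_def children_def words_def dest: in_set_butlastD)
  then show "k \<in> (\<Union>j\<in>level N n. children N j)" by blast
qed (auto simp: level_def children_def)

lemma finite_children: "j \<in> words N \<Longrightarrow> finite (children N j)"
  by (simp add: children_eq)

lemma finite_level: "finite (level N n)"
proof -
  have "level N n = {j. set j \<subseteq> {1..N} \<and> length j = n}"
    by (auto simp: level_def words_def)
  then show ?thesis by (simp add: finite_lists_length_eq)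
qed

lemma sum_level_Suc: "(\<Sum>k\<in>level N (Suc n). F k) = (\<Sum>j\<in>level N n. \<Sum>k\<in>children N j. F k)"
  unfolding level_Suc
proof (rule sum.UNION_disjoint)
  show "\<forall>j\<in>level N n. finite (children N j)"
    by (auto simp: level_def finite_children)
qed (auto simp: finite_level children_def)

section \<open>The model with repeated coefficients\<close>

locale repeated_tree =
  fixes N :: nat and d :: "nat list \<Rightarrow> real" and \<Omega> :: "'w set" and \<delta> :: "'w \<Rightarrow> real"
    and \<alpha> f :: real
  assumes repeated: "repeated_coefficients N d \<Omega> \<delta>"
    and N_pos: "0 < N" and f_pos: "0 < f" and d_root: "d [] = 1"
begin

lemma card_Omega: "card \<Omega> = N"
  using repeated by (simp add: repeated_coefficients_def)

end

sublocale repeated_tree \<subseteq> positive_family \<Omega> \<delta>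
  using repeated N_pos by unfold_locales (auto simp: repeated_coefficients_def)

context repeated_tree
begin

text \<open>Equality of multisets is used here in the form that sums over the children of a function
  of \<open>d\<close> are the same at every node.\<close>

lemma sum_children:
  assumes "j \<in> words N"
  shows "(\<Sum>k\<in>children N j. \<phi> (d k)) = (\<Sum>\<omega>\<in>\<Omega>. \<phi> (\<delta> \<omega>))"
proof -
  have "image_mset d (mset_set (children N j)) = image_mset \<delta> (mset_set \<Omega>)"
    using repeated assms by (simp add: repeated_coefficients_def)
  then have "\<Sum>\<^sub># (image_mset \<phi> (image_mset d (mset_set (children N j)))) =
      \<Sum>\<^sub># (image_mset \<phi> (image_mset \<delta> (mset_set \<Omega>)))"
    by simp
  then show ?thesis by (simp add: sum_unfold_sum_mset multiset.map_comp comp_def)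
qed

lemma d_child_in_image:
  assumes "j \<in> words N" "k \<in> children N j"
  shows "d k \<in> \<delta> ` \<Omega>"
proof -
  have "image_mset d (mset_set (children N j)) = image_mset \<delta> (mset_set \<Omega>)"
    using repeated assms by (simp add: repeated_coefficients_def)
  then have "set_mset (image_mset d (mset_set (children N j))) = set_mset (image_mset \<delta> (mset_set \<Omega>))"
    by simp
  then have "d ` children N j = \<delta> ` \<Omega>"
    using finite_A assms by (simp add: finite_children)
  then show ?thesis using assms(2) by blast
qed

lemma d_pos: "j \<in> words N \<Longrightarrow> 0 < d j"
proof (induction rule: words_induct)
  case (child j k)
  then have "d k \<in> \<delta> ` \<Omega>" by (intro d_child_in_image)
  then show ?case using x_pos by auto
qed (simp add: d_root)

lemma children_nonempty: "j \<in> words N \<Longrightarrow> children N j \<noteq> {}"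
  using N_pos by (simp add: children_eq)

section \<open>The geometric solution\<close>

text \<open>The positive root \<open>y\<close> of the cubic equation obtained from the ansatz that
  \<open>u\<close> at a node is \<open>y * sqrt\<close> of the coefficient times the parent's
  value.\<close>

definition ratio :: real where
  "ratio = (2 powr \<alpha> * S (3 / 2)) powr (- 1 / 3)"

lemma ratio_pos: "0 < ratio"
  using S_pos[of "3 / 2"] by (simp add: ratio_def)

lemma ratio_cube: "ratio ^ 3 * (2 powr \<alpha> * S (3 / 2)) = 1"
proof -
  define q where "q = 2 powr \<alpha> * S (3 / 2)"
  have q: "0 < q" using S_pos[of "3 / 2"] by (simp add: q_def)
  have "ratio ^ 3 = q powr (- 1)"
    using q by (simp add: ratio_def powr_powr flip: q_def powr_realpow)
  also have "\<dots> = 1 / q" using q by (simp add: powr_minus_divide)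
  finally show ?thesis using q by (simp flip: q_def)
qed

lemma log_ratio: "log 2 ratio = - (\<alpha> + log 2 (S (3 / 2))) / 3"
  using S_pos[of "3 / 2"] unfolding ratio_def log_powr by (simp add: log_mult field_simps)

definition geometric :: "(nat list \<Rightarrow> real) \<Rightarrow> bool" where
  "geometric u \<longleftrightarrow> (\<forall>j\<in>words N. u j = parent_value f u j * (ratio * sqrt (d j)))"

lemma parent_value_child: "k \<in> children N j \<Longrightarrow> parent_value f u k = u j"
  by (auto simp: parent_value_def children_def)

lemma parent_value_Nil: "parent_value f u [] = f"
  by (simp add: parent_value_def)

lemma geometric_Nil: "geometric u \<Longrightarrow> u [] = f * ratio"
  unfolding geometric_def using Nil_in_words[of N] by (force simp: parent_value_Nil d_root)

lemma geometric_child: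
  assumes "geometric u" "k \<in> children N j"
  shows "u k = u j * (ratio * sqrt (d k))"
proof -
  have "k \<in> words N" using assms(2) children_subset_words by blast
  then have "u k = parent_value f u k * (ratio * sqrt (d k))"
    using assms(1) unfolding geometric_def by blast
  then show ?thesis using parent_value_child[OF assms(2)] by simp
qed

lemma geometric_pos:
  assumes "geometric u" "j \<in> words N"
  shows "0 < u j"
  using assms(2)
proof (induction rule: words_induct)
  case Nil
  then show ?case using geometric_Nil[OF assms(1)] f_pos ratio_pos by simp
next
  case (child j k)
  have "k \<in> words N" using child.hyps children_subset_words by blast
  then show ?case
    using geometric_child[OF assms(1) child.hyps(2)] child.IH ratio_pos d_pos by simp
qed

lemma geometric_unique:
  assumes "geometric u" "geometric v" "j \<in> words N"
  shows "u j = v j"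
  using assms(3)
  by (induction rule: words_induct) (simp_all add: geometric_Nil geometric_child assms(1,2))

text \<open>Unfolding the recursion along the path from the root gives an explicit product.\<close>

lemma ex_geometric: "\<exists>u. geometric u \<and> u \<in> extensional (words N)"
proof -
  \<comment> \<open>The words \<open>take i j\<close> with \<open>1 <= i <= length j\<close> are the
    nonempty prefixes of \<open>j\<close>, including \<open>j\<close> itself. The root contributes
    \<open>f * ratio\<close>, since its coefficient is 1.\<close>
  define u where "u = restrict (\<lambda>j. f * ratio * (\<Prod>i=1..length j. ratio * sqrt (d (take i j)))) (words N)"
  have "u j = parent_value f u j * (ratio * sqrt (d j))" if j: "j \<in> words N" for j
  proof (cases j rule: rev_cases)
    case Nil
    then show ?thesis using j by (simp add: u_def parent_value_Nil d_root)
  next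
    case (snoc i a)
    have i: "i \<in> words N" using j snoc by (simp add: words_def)
    have "(\<Prod>m=1..length i. ratio * sqrt (d (take m j))) = (\<Prod>m=1..length i. ratio * sqrt (d (take m i)))"
      using snoc by (intro prod.cong) auto
    then show ?thesis
      using j i snoc by (simp add: u_def parent_value_def)
  qed
  then show ?thesis
    by (intro exI[of _ u]) (auto simp: geometric_def u_def)
qed

lemma powr_three_halves: "0 < (x::real) \<Longrightarrow> x * sqrt x = x powr (3 / 2)"
  by (simp add: powr_half_sqrt[symmetric] powr_mult_base)

lemma geometric_constant_solution:
  assumes "geometric u" "u \<in> extensional (words N)"
  shows "constant_solution N \<alpha> f d u"
  unfolding constant_solution_def
proof (intro conjI ballI)
  show "u \<in> words N \<rightarrow>\<^sub>E {0..}"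
    using assms geometric_pos[OF assms(1)] by (auto simp: PiE_def less_imp_le)
next
  fix j assume j: "j \<in> words N"
  define v where "v = parent_value f u j"
  define E where "E = 2 powr (\<alpha> * real (length j))"
  have uj: "u j = v * (ratio * sqrt (d j))"
    using assms(1) j by (simp add: geometric_def v_def)
  have "(\<Sum>k\<in>children N j. coeff_c \<alpha> d k * u j * u k)
      = (\<Sum>k\<in>children N j. (E * 2 powr \<alpha> * (u j)\<^sup>2 * ratio) * (d k powr (3 / 2)))"
  proof (rule sum.cong[OF refl])
    fix k assume k: "k \<in> children N j"
    then have len: "length k = Suc (length j)" by (auto simp: children_def)
    have "0 < d k" using k children_subset_words d_pos by blast
    then show "coeff_c \<alpha> d k * u j * u k = (E * 2 powr \<alpha> * (u j)\<^sup>2 * ratio) * (d k powr (3 / 2))"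
      using geometric_child[OF assms(1) k]
      by (simp add: powr_three_halves[symmetric] coeff_c_def len E_def powr_add distrib_left
          power2_eq_square)
  qed
  also have "\<dots> = E * 2 powr \<alpha> * (u j)\<^sup>2 * ratio * S (3 / 2)"
    using sum_children[OF j, of "\<lambda>x. x powr (3 / 2)"]
    by (simp add: power_sum_def flip: sum_distrib_left)
  \<comment> \<open>The cube of \<open>ratio\<close> collects two factors from the square of
    \<open>u j\<close> and one from the children.\<close>
  also have "\<dots> = E * v\<^sup>2 * (sqrt (d j))\<^sup>2 * (ratio ^ 3 * (2 powr \<alpha> * S (3 / 2)))"
    unfolding uj by (simp add: power_mult_distrib power2_eq_square power3_eq_cube)
  also have "\<dots> = coeff_c \<alpha> d j * v\<^sup>2"
    using d_pos[OF j] by (simp add: ratio_cube coeff_c_def E_def)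
  finally show "coeff_c \<alpha> d j * (parent_value f u j)\<^sup>2 = (\<Sum>k\<in>children N j. coeff_c \<alpha> d k * u j * u k)"
    by (simp add: v_def)
qed

section \<open>Level sums, energy and structure exponents of the geometric solution\<close>

text \<open>Passing from a node to its children multiplies the sum of \<open>p\<close>-th powers by
  a factor that is the same at every node.\<close>

lemma geometric_sum_level:
  assumes "geometric u"
  shows "(\<Sum>j\<in>level N n. u j powr p) = (f * ratio) powr p * (ratio powr p * S (p / 2)) ^ n"
proof (induction n)
  case 0
  show ?case using geometric_Nil[OF assms] f_pos ratio_pos by (simp add: level_0)
next
  case (Suc n)
  have "(\<Sum>k\<in>children N j. u k powr p) = u j powr p * (ratio powr p * S (p / 2))"
    if "j \<in> level N n" for j
  proof -
    have j: "j \<in> words N" using that by (simp add: level_def)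
    have "(\<Sum>k\<in>children N j. u k powr p)
        = (\<Sum>k\<in>children N j. u j powr p * ratio powr p * d k powr (p / 2))"
    proof (rule sum.cong[OF refl])
      fix k assume k: "k \<in> children N j"
      then have "0 < d k" using children_subset_words d_pos by blast
      then show "u k powr p = u j powr p * ratio powr p * d k powr (p / 2)"
        using geometric_child[OF assms k] geometric_pos[OF assms j] ratio_pos
        by (simp add: powr_mult powr_powr powr_half_sqrt[symmetric])
    qed
    also have "\<dots> = u j powr p * ratio powr p * S (p / 2)"
      using sum_children[OF j, of "\<lambda>x. x powr (p / 2)"]
      by (simp add: power_sum_def flip: sum_distrib_left)
    finally show ?thesis by simp
  qed
  then have "(\<Sum>k\<in>level N (Suc n). u k powr p)
      = (\<Sum>j\<in>level N n. u j powr p) * (ratio powr p * S (p / 2))"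
    by (simp add: sum_level_Suc sum_distrib_right)
  then show ?case using Suc.IH by simp
qed

text \<open>
  The energies of the levels decay by Jensen's inequality in the form \<open>L 1 \<le> L (3 / 2)\<close>.
\<close>

lemma energy_ratio_less_one:
  assumes "real N < 2 powr (2 * \<alpha>)"
  shows "ratio powr 2 * S 1 < 1"
proof -
  have "log 2 (real N) < 2 * \<alpha>"
    using assms N_pos by (simp add: log_less_iff)
  moreover have "L 1 \<le> L (3 / 2)"
    using L_mono by (simp add: monoD)
  \<comment> \<open>The left side equals
    \<open>(log 2 N - 2 * \<alpha>) / 3 + L 1 - L (3 / 2)\<close>.\<close>
  ultimately have "2 * log 2 ratio + log 2 (S 1) < 0"
    using log_S_eq[of 1] log_S_eq[of "3 / 2"] by (simp add: log_ratio card_Omega field_simps)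
  then have "log 2 (ratio powr 2 * S 1) < 0"
    using S_pos[of 1] ratio_pos unfolding log_powr[symmetric] by (simp add: log_mult)
  then show ?thesis
    using S_pos[of 1] ratio_pos by simp
qed

text \<open>Any finite set of words lies in finitely many levels, whose energies are terms of a
  convergent geometric series.\<close>

lemma geometric_finite_energy:
  assumes "geometric u" "real N < 2 powr (2 * \<alpha>)"
  shows "finite_energy N u"
  unfolding finite_energy_def
proof (rule nonneg_bdd_above_summable_on)
  define \<rho> where "\<rho> = ratio powr 2 * S 1"
  have \<rho>: "0 < \<rho>" "\<rho> < 1"
    using energy_ratio_less_one[OF assms(2)] ratio_pos S_pos[of 1] by (auto simp: \<rho>_def)
  have level: "(\<Sum>j\<in>level N n. (u j)\<^sup>2) = (f * ratio)\<^sup>2 * \<rho> ^ n" for n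
  proof -
    have "(\<Sum>j\<in>level N n. (u j)\<^sup>2) = (\<Sum>j\<in>level N n. u j powr 2)"
      using geometric_pos[OF assms(1)] by (intro sum.cong) (auto simp: level_def powr_realpow[of _ 2, simplified])
    then show ?thesis
      using geometric_sum_level[OF assms(1), of 2 n] f_pos ratio_pos by (simp add: \<rho>_def)
  qed
  show "bdd_above (sum (\<lambda>j. (u j)\<^sup>2) ` {F. F \<subseteq> words N \<and> finite F})"
  proof (rule bdd_aboveI2)
    fix F assume "F \<in> {F. F \<subseteq> words N \<and> finite F}"
    then have F: "F \<subseteq> words N" "finite F" by auto
    \<comment> \<open>The successor makes the strict range \<open>n < m\<close> reach the longest
      word; inserting 0 covers an empty \<open>F\<close>.\<close>
    define m where "m = Suc (Max (insert 0 (length ` F)))"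
    have "length j < m" if "j \<in> F" for j
      unfolding m_def using F(2) that by (intro le_imp_less_Suc Max_ge) auto
    then have sub: "F \<subseteq> (\<Union>n<m. level N n)"
      using F(1) by (auto simp: level_def)
    have "(\<Sum>j\<in>F. (u j)\<^sup>2) \<le> (\<Sum>j\<in>(\<Union>n<m. level N n). (u j)\<^sup>2)"
      using sub by (intro sum_mono2) (auto simp: finite_level)
    also have "\<dots> = (\<Sum>n<m. \<Sum>j\<in>level N n. (u j)\<^sup>2)"
      by (rule sum.UNION_disjoint) (auto simp: finite_level, auto simp: level_def)
    also have "\<dots> = (f * ratio)\<^sup>2 * (\<Sum>n<m. \<rho> ^ n)"
      by (simp add: level sum_distrib_left)
    also have "\<dots> \<le> (f * ratio)\<^sup>2 * (1 / (1 - \<rho>))"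
    proof (rule mult_left_mono)
      show "(\<Sum>n<m. \<rho> ^ n) \<le> 1 / (1 - \<rho>)"
        using \<rho> sum_le_suminf[of "\<lambda>n. \<rho> ^ n" "{..<m}"] by (simp add: suminf_geometric summable_geometric)
    qed simp
    finally show "(\<Sum>j\<in>F. (u j)\<^sup>2) \<le> (f * ratio)\<^sup>2 * (1 / (1 - \<rho>))" .
  qed
qed simp

text \<open>The logarithms of the level sums are affine in \<open>n\<close>, so the upper limit is a
  limit, namely their slope.\<close>

lemma geometric_structure_exponent:
  assumes "geometric u"
  shows "structure_exponent dm N u p =
    ereal (min p (real dm - p / 2 * real dm - p * log 2 ratio - log 2 (S (p / 2))))"
proof -
  define C where "C = p * log 2 (f * ratio)"
  define R where "R = p * log 2 ratio + log 2 (S (p / 2))"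
  have eq: "log 2 (\<Sum>j\<in>level N n. \<bar>u j\<bar> powr p) = C + real n * R" for n
  proof -
    have "(\<Sum>j\<in>level N n. \<bar>u j\<bar> powr p) = (\<Sum>j\<in>level N n. u j powr p)"
      using geometric_pos[OF assms] by (intro sum.cong) (auto simp: level_def abs_of_pos)
    then show ?thesis
      using f_pos ratio_pos S_pos[of "p / 2"]
      by (simp add: geometric_sum_level[OF assms] C_def R_def log_mult log_powr log_nat_power)
  qed
  have "(\<lambda>n. C / real n + R) \<longlonglongrightarrow> R"
    by real_asymp
  \<comment> \<open>The two expressions are compared only for positive \<open>n\<close>, because
    division by 0 yields 0.\<close>
  moreover have "\<forall>\<^sub>F n in sequentially. C / real n + R = 1 / real n * (C + real n * R)"
    using eventually_gt_at_top[of 0] by eventually_elim (simp add: field_simps)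
  ultimately have "(\<lambda>n. 1 / real n * (C + real n * R)) \<longlonglongrightarrow> R"
    by (rule Lim_transform_eventually)
  then have "(\<lambda>n. ereal (1 / real n * log 2 (\<Sum>j\<in>level N n. \<bar>u j\<bar> powr p))) \<longlonglongrightarrow> ereal R"
    unfolding eq by simp
  then have "limsup (\<lambda>n. ereal (1 / real n * log 2 (\<Sum>j\<in>level N n. \<bar>u j\<bar> powr p))) = ereal R"
    by (intro lim_imp_Limsup) auto
  then show ?thesis
    by (simp add: structure_exponent_def R_def min_def)
qed

section \<open>Every finite-energy solution is geometric\<close>

text \<open>A positive parent value makes the left side of the equation positive, which excludes
  \<open>u j = 0\<close>; positivity thus spreads from \<open>f\<close> down the tree and allows
  division by parent values.\<close>

lemma solution_pos:
  assumes sol: "constant_solution N \<alpha> f d u" and "j \<in> words N"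
  shows "0 < u j"
proof -
  have step: "0 < u j" if "j \<in> words N" "0 < parent_value f u j" for j
  proof -
    have "coeff_c \<alpha> d j * (parent_value f u j)\<^sup>2 = u j * (\<Sum>k\<in>children N j. coeff_c \<alpha> d k * u k)"
      using sol that(1) by (simp add: constant_solution_def sum_distrib_left mult.commute mult.left_commute)
    moreover have "0 < coeff_c \<alpha> d j * (parent_value f u j)\<^sup>2"
      using that d_pos by (simp add: coeff_c_def)
    ultimately have "u j \<noteq> 0" by auto
    moreover have "0 \<le> u j"
      using sol that(1) by (auto simp: constant_solution_def)
    ultimately show ?thesis by simp
  qed
  show ?thesis
    using assms(2)
  proof (induction rule: words_induct)
    case Nil
    then show ?case using step[of "[]"] f_pos Nil_in_words by (simp add: parent_value_Nil)
  next
    case (child j k)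
    have "k \<in> words N" using child.hyps children_subset_words by blast
    then show ?case
      using step child by (simp add: parent_value_child)
  qed
qed

text \<open>Normalised so that it is identically 1 for the geometric solution.\<close>

definition defect :: "(nat list \<Rightarrow> real) \<Rightarrow> nat list \<Rightarrow> real" where
  "defect u j = u j / (parent_value f u j * (ratio * sqrt (d j)))"

lemma parent_value_pos:
  assumes sol: "constant_solution N \<alpha> f d u" and j: "j \<in> words N"
  shows "0 < parent_value f u j"
proof (cases "j = []")
  case False
  then have "butlast j \<in> words N" using j by (auto simp: words_def dest: in_set_butlastD)
  then show ?thesis using solution_pos[OF sol] False by (simp add: parent_value_def)
qed (simp add: parent_value_Nil f_pos)

lemma defect_pos:
  assumes "constant_solution N \<alpha> f d u" "j \<in> words N"
  shows "0 < defect u j"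
  using solution_pos[OF assms] parent_value_pos[OF assms] ratio_pos d_pos[OF assms(2)]
  by (simp add: defect_def)

lemma solution_eq_defect:
  assumes "constant_solution N \<alpha> f d u" "j \<in> words N"
  shows "u j = defect u j * parent_value f u j * ratio * sqrt (d j)"
  using parent_value_pos[OF assms] ratio_pos d_pos[OF assms(2)]
  by (simp add: defect_def)

text \<open>Write each \<open>u k\<close> as its defect times the geometric prediction and divide by
  the left side of the equation; \<open>ratio_cube\<close> then removes the constants.\<close>

lemma defect_recursion:
  assumes sol: "constant_solution N \<alpha> f d u" and j: "j \<in> words N"
  shows "(defect u j)\<^sup>2 * (\<Sum>k\<in>children N j. d k powr (3 / 2) * defect u k) = S (3 / 2)"
proof -
  define v where "v = parent_value f u j"
  define E where "E = 2 powr (\<alpha> * real (length j))"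
  define T where "T = (\<Sum>k\<in>children N j. d k powr (3 / 2) * defect u k)"
  have uj: "u j = defect u j * v * ratio * sqrt (d j)"
    using solution_eq_defect[OF assms] by (simp add: v_def)
  have "coeff_c \<alpha> d j * v\<^sup>2 = (\<Sum>k\<in>children N j. coeff_c \<alpha> d k * u j * u k)"
    using sol j by (simp add: constant_solution_def v_def)
  also have "\<dots> = (\<Sum>k\<in>children N j. (E * 2 powr \<alpha> * (u j)\<^sup>2 * ratio) * (d k powr (3 / 2) * defect u k))"
  proof (rule sum.cong[OF refl])
    fix k assume k: "k \<in> children N j"
    then have len: "length k = Suc (length j)" by (auto simp: children_def)
    have kw: "k \<in> words N" using k children_subset_words by blast
    have "u k = defect u k * u j * ratio * sqrt (d k)"
      using solution_eq_defect[OF sol kw] parent_value_child[OF k] by simp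
    then show "coeff_c \<alpha> d k * u j * u k
        = (E * 2 powr \<alpha> * (u j)\<^sup>2 * ratio) * (d k powr (3 / 2) * defect u k)"
      using d_pos[OF kw]
      by (simp add: powr_three_halves[symmetric] coeff_c_def len E_def powr_add distrib_left
          power2_eq_square)
  qed
  also have "\<dots> = E * 2 powr \<alpha> * (u j)\<^sup>2 * ratio * T"
    by (simp add: T_def sum_distrib_left)
  also have "\<dots> = E * v\<^sup>2 * (sqrt (d j))\<^sup>2 * ((defect u j)\<^sup>2 * (ratio ^ 3 * 2 powr \<alpha> * T))"
    unfolding uj by (simp add: power_mult_distrib power2_eq_square power3_eq_cube)
  also have "\<dots> = coeff_c \<alpha> d j * v\<^sup>2 * ((defect u j)\<^sup>2 * (ratio ^ 3 * 2 powr \<alpha> * T))"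
    using d_pos[OF j] by (simp add: coeff_c_def E_def)
  finally have "(defect u j)\<^sup>2 * (ratio ^ 3 * 2 powr \<alpha> * T) = 1"
    using d_pos[OF j] parent_value_pos[OF assms] by (simp add: coeff_c_def v_def)
  then have "ratio ^ 3 * 2 powr \<alpha> * ((defect u j)\<^sup>2 * T) = ratio ^ 3 * 2 powr \<alpha> * S (3 / 2)"
    using ratio_cube by (simp add: mult.commute mult.left_commute)
  then show ?thesis
    using ratio_pos by (simp add: T_def)
qed

text \<open>By the recursion, \<open>1 / (defect u j)\<^sup>2\<close> is a weighted mean of the
  children's defects with weights \<open>d k powr (3 / 2)\<close>, and a mean is at most the largest
  value.\<close>

lemma ex_child_defect_ge:
  assumes sol: "constant_solution N \<alpha> f d u" and j: "j \<in> words N"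
  shows "\<exists>k\<in>children N j. 1 / (defect u j)\<^sup>2 \<le> defect u k"
proof (rule ccontr)
  assume "\<not> ?thesis"
  then have less: "defect u k < 1 / (defect u j)\<^sup>2" if "k \<in> children N j" for k
    using that by (meson not_le)
  have "(\<Sum>k\<in>children N j. d k powr (3 / 2) * defect u k)
      < (\<Sum>k\<in>children N j. d k powr (3 / 2) * (1 / (defect u j)\<^sup>2))"
    using less d_pos children_subset_words[of N j]
    by (intro sum_strict_mono finite_children children_nonempty j mult_strict_left_mono)
      (auto simp: less_imp_neq[symmetric] subset_iff)
  also have "\<dots> = S (3 / 2) / (defect u j)\<^sup>2"
    using sum_children[OF j, of "\<lambda>x. x powr (3 / 2)"]
    by (simp add: power_sum_def flip: sum_divide_distrib)
  finally show False
    using defect_recursion[OF assms] defect_pos[OF assms] by (simp add: field_simps)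
qed

text \<open>The same mean is at least the smallest value.\<close>

lemma ex_child_defect_le:
  assumes sol: "constant_solution N \<alpha> f d u" and j: "j \<in> words N"
  shows "\<exists>k\<in>children N j. defect u k \<le> 1 / (defect u j)\<^sup>2"
proof (rule ccontr)
  assume "\<not> ?thesis"
  then have less: "1 / (defect u j)\<^sup>2 < defect u k" if "k \<in> children N j" for k
    using that by (meson not_le)
  have "S (3 / 2) / (defect u j)\<^sup>2 = (\<Sum>k\<in>children N j. d k powr (3 / 2) * (1 / (defect u j)\<^sup>2))"
    using sum_children[OF j, of "\<lambda>x. x powr (3 / 2)"]
    by (simp add: power_sum_def flip: sum_divide_distrib)
  also have "\<dots> < (\<Sum>k\<in>children N j. d k powr (3 / 2) * defect u k)"
    using less d_pos children_subset_words[of N j]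
    by (intro sum_strict_mono finite_children children_nonempty j mult_strict_left_mono)
      (auto simp: less_imp_neq[symmetric] subset_iff)
  finally show False
    using defect_recursion[OF assms] defect_pos[OF assms] by (simp add: field_simps)
qed

text \<open>A lower bound for the factor that two generations of the geometric solution apply to
  \<open>u\<close>.\<close>

abbreviation "\<kappa> \<equiv> ratio\<^sup>2 * Min (\<delta> ` \<Omega>)"

lemma Min_pos: "0 < Min (\<delta> ` \<Omega>)"
  using finite_A A_nonempty x_pos by (subst Min_gr_iff) auto

text \<open>
  A node of defect \<open>s\<close> has a child of defect at most \<open>s\<^sup>-\<^sup>2\<close>, which in turn has a child of defect at
  least \<open>s\<^sup>4\<close>.
\<close>

lemma ex_grandchild_growth:
  assumes sol: "constant_solution N \<alpha> f d u" and j: "j \<in> words N"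
  obtains l where "l \<in> words N" "defect u j ^ 4 \<le> defect u l"
    "\<kappa> * u j * sqrt (defect u l) \<le> u l"
proof -
  obtain k where k: "k \<in> children N j" "defect u k \<le> 1 / (defect u j)\<^sup>2"
    using ex_child_defect_le[OF sol j] by blast
  have kw: "k \<in> words N" using k(1) children_subset_words by blast
  obtain l where l: "l \<in> children N k" "1 / (defect u k)\<^sup>2 \<le> defect u l"
    using ex_child_defect_ge[OF sol kw] by blast
  have lw: "l \<in> words N" using l(1) children_subset_words by blast
  note pos = defect_pos[OF sol j] defect_pos[OF sol kw] defect_pos[OF sol lw] solution_pos[OF sol j]
  have "(defect u k)\<^sup>2 \<le> (1 / (defect u j)\<^sup>2)\<^sup>2"
    using k(2) pos by (intro power_mono) auto
  then have "(defect u k)\<^sup>2 * defect u j ^ 4 \<le> 1"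
    using pos by (simp add: power_divide field_simps flip: power_mult)
  then have "defect u j ^ 4 \<le> 1 / (defect u k)\<^sup>2"
    using pos by (simp add: field_simps)
  then have growth: "defect u j ^ 4 \<le> defect u l" using l(2) by simp
  \<comment> \<open>The intermediate node may have a tiny defect. Its product with the defect of
    \<open>l\<close> is still at least the square root of the latter, so \<open>u\<close> cannot
    lose on the way what it gains at \<open>l\<close>.\<close>
  have "1 \<le> defect u l * (defect u k)\<^sup>2"
    using l(2) pos by (simp add: field_simps)
  then have "1 \<le> sqrt (defect u l * (defect u k)\<^sup>2)" by simp
  then have "1 \<le> sqrt (defect u l) * defect u k"
    using pos by (simp add: real_sqrt_mult)
  then have "sqrt (defect u l) * 1 \<le> sqrt (defect u l) * (sqrt (defect u l) * defect u k)"
    using pos by (intro mult_left_mono) auto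
  then have sk: "sqrt (defect u l) \<le> defect u k * defect u l"
    using pos unfolding mult.assoc[symmetric] by (simp add: mult.commute[of "defect u k"])
  define \<mu> where "\<mu> = Min (\<delta> ` \<Omega>)"
  have "\<mu> \<le> d k" "\<mu> \<le> d l"
    unfolding \<mu>_def using d_child_in_image[OF j k(1)] d_child_in_image[OF kw l(1)] finite_A
    by (auto intro: Min_le)
  then have "sqrt \<mu> * sqrt \<mu> \<le> sqrt (d k) * sqrt (d l)"
    using Min_pos by (intro mult_mono) (auto simp: \<mu>_def)
  then have sd: "\<mu> \<le> sqrt (d k) * sqrt (d l)"
    using Min_pos by (simp add: \<mu>_def)
  have "ratio\<^sup>2 * \<mu> * u j * sqrt (defect u l)
      \<le> ratio\<^sup>2 * (sqrt (d k) * sqrt (d l)) * u j * (defect u k * defect u l)"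
    using sd sk pos Min_pos d_pos[OF kw] d_pos[OF lw]
    by (intro mult_mono) (auto simp: \<mu>_def)
  also have "\<dots> = u l"
    using solution_eq_defect[OF sol kw] solution_eq_defect[OF sol lw]
      parent_value_child[OF k(1), of u] parent_value_child[OF l(1), of u]
    by (simp add: power2_eq_square)
  finally show thesis using that lw growth by (simp add: \<mu>_def)
qed

text \<open>A defect above 1 is raised at least to the fourth power every two generations, hence
  grows doubly exponentially along a branch. The competing factor \<open>\<kappa> ^ n\<close> is
  only exponential, so \<open>u\<close> is unbounded there, against finite energy.\<close>

lemma defect_le_one:
  assumes sol: "constant_solution N \<alpha> f d u" and energy: "finite_energy N u" and j: "j \<in> words N"
  shows "defect u j \<le> 1"
proof (rule ccontr)
  assume "\<not> ?thesis"
  then have gt: "1 < defect u j" by simp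
  define s where "s = defect u j"
  \<comment> \<open>Chosen so that the lower bound on \<open>u\<close> below is an equality for
    \<open>n = 0\<close>.\<close>
  define C where "C = u j / sqrt s"
  have C: "0 < C" using solution_pos[OF sol j] gt by (simp add: C_def s_def)
  have \<kappa>: "0 < \<kappa>" using Min_pos ratio_pos by simp
  have iter: "\<exists>l\<in>words N. s ^ (4 ^ n) \<le> defect u l \<and> C * \<kappa> ^ n * sqrt (defect u l) \<le> u l" for n
  proof (induction n)
    case 0
    show ?case using j gt by (intro bexI[of _ j]) (auto simp: s_def C_def)
  next
    case (Suc n)
    then obtain l where l: "l \<in> words N" "s ^ (4 ^ n) \<le> defect u l"
      "C * \<kappa> ^ n * sqrt (defect u l) \<le> u l" by blast
    obtain l' where l': "l' \<in> words N" "defect u l ^ 4 \<le> defect u l'"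
      "\<kappa> * u l * sqrt (defect u l') \<le> u l'" by (rule ex_grandchild_growth[OF sol l(1)])
    have "1 \<le> s ^ (4 ^ n)" using gt by (simp add: s_def one_le_power)
    then have ge1: "1 \<le> defect u l" using l(2) by simp
    have "s ^ (4 ^ Suc n) = (s ^ (4 ^ n)) ^ 4"
      by (simp add: mult.commute flip: power_mult)
    also have "\<dots> \<le> defect u l ^ 4"
      using l(2) gt by (intro power_mono) (auto simp: s_def)
    finally have 1: "s ^ (4 ^ Suc n) \<le> defect u l'" using l'(2) by simp
    have "C * \<kappa> ^ n * 1 \<le> C * \<kappa> ^ n * sqrt (defect u l)"
      using C \<kappa> ge1 by (intro mult_left_mono) auto
    then have "C * \<kappa> ^ n \<le> u l" using l(3) by simp
    then have "\<kappa> * (C * \<kappa> ^ n) * sqrt (defect u l') \<le> \<kappa> * u l * sqrt (defect u l')"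
      using \<kappa> defect_pos[OF sol l'(1)] by (intro mult_right_mono mult_left_mono) auto
    then have "C * \<kappa> ^ Suc n * sqrt (defect u l') \<le> u l'"
      using l'(3) by (simp add: mult.commute mult.left_commute)
    then show ?case using 1 l'(1) by blast
  qed
  \<comment> \<open>The total energy bounds every single square.\<close>
  define B where "B = (\<Sum>\<^sub>\<infinity>j\<in>words N. (u j)\<^sup>2)"
  have bound: "(u l)\<^sup>2 \<le> B" if "l \<in> words N" for l
    using finite_sum_le_infsum[of "\<lambda>j. (u j)\<^sup>2" "words N" "{l}"] energy that
    by (simp add: B_def finite_energy_def)
  have below: "C\<^sup>2 * (\<kappa>\<^sup>2) ^ n * s ^ (4 ^ n) \<le> B" for n
  proof -
    obtain l where l: "l \<in> words N" "s ^ (4 ^ n) \<le> defect u l"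
      "C * \<kappa> ^ n * sqrt (defect u l) \<le> u l" using iter by blast
    have "C\<^sup>2 * (\<kappa>\<^sup>2) ^ n * s ^ (4 ^ n) \<le> C\<^sup>2 * (\<kappa>\<^sup>2) ^ n * defect u l"
      using l(2) C \<kappa> by (intro mult_left_mono) auto
    also have "\<dots> = (C * \<kappa> ^ n * sqrt (defect u l))\<^sup>2"
      using defect_pos[OF sol l(1)] by (simp add: power_mult_distrib mult.commute flip: power_mult)
    also have "\<dots> \<le> (u l)\<^sup>2"
      using l(3) C \<kappa> defect_pos[OF sol l(1)] by (intro power_mono) auto
    finally show ?thesis using bound[OF l(1)] by simp
  qed
  have "filterlim (\<lambda>n. c * k ^ n * b ^ (4 ^ n)) at_top sequentially"
    if "0 < c" "0 < k" "1 < b" for c k b :: real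
  proof -
    \<comment> \<open>In exponential form the term \<open>H * 4 ^ n\<close> dominates the linear
      term, whatever the sign of \<open>K\<close>.\<close>
    have "filterlim (\<lambda>n. c * exp (K * real n + H * 4 ^ n)) at_top sequentially"
      if "0 < H" for K H :: real
      using that \<open>0 < c\<close> by real_asymp
    from this[of "ln b" "ln k"]
    have "filterlim (\<lambda>n. c * exp (ln k * real n + ln b * 4 ^ n)) at_top sequentially"
      using that by simp
    moreover have "exp (ln k * real n + ln b * 4 ^ n) = k ^ n * b ^ (4 ^ n)" for n
      using that exp_of_nat2_mult[of "ln k" n] exp_of_nat2_mult[of "ln b" "4 ^ n"]
      by (simp add: exp_add)
    ultimately show ?thesis by (simp add: mult.assoc)
  qed
  from this[of "C\<^sup>2" "\<kappa>\<^sup>2" s]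
  have "filterlim (\<lambda>n. C\<^sup>2 * (\<kappa>\<^sup>2) ^ n * s ^ (4 ^ n)) at_top sequentially"
    using C zero_less_power[OF \<kappa>, of 2] gt by (simp only: s_def zero_less_power)
  then have "\<forall>\<^sub>F n in sequentially. B < C\<^sup>2 * (\<kappa>\<^sup>2) ^ n * s ^ (4 ^ n)"
    by (simp add: filterlim_at_top_dense)
  then obtain n where "B < C\<^sup>2 * (\<kappa>\<^sup>2) ^ n * s ^ (4 ^ n)"
    using eventually_happens[of _ sequentially] by auto
  then show False using below[of n] by simp
qed

text \<open>A defect below 1 is excluded too: such a node would have a child of defect above 1. So
  all defects equal 1.\<close>

lemma solution_geometric:
  assumes sol: "constant_solution N \<alpha> f d u" and energy: "finite_energy N u"
  shows "geometric u"
  unfolding geometric_def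
proof
  fix j assume j: "j \<in> words N"
  obtain k where k: "k \<in> children N j" "1 / (defect u j)\<^sup>2 \<le> defect u k"
    using ex_child_defect_ge[OF sol j] by blast
  have "defect u k \<le> 1"
    using defect_le_one[OF sol energy] k(1) children_subset_words by blast
  then have "1 / (defect u j)\<^sup>2 \<le> 1" using k(2) by simp
  then have "1 \<le> (defect u j)\<^sup>2"
    using defect_pos[OF sol j] by (simp add: field_simps)
  then have "1 \<le> defect u j"
    using defect_pos[OF sol j] power2_le_imp_le[of 1 "defect u j"] by simp
  then have "defect u j = 1"
    using defect_le_one[OF sol energy j] by simp
  then show "u j = parent_value f u j * (ratio * sqrt (d j))"
    using solution_eq_defect[OF sol j] by simp
qed

theorem ex1_solution:
  assumes "real N < 2 powr (2 * \<alpha>)"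
  shows "\<exists>!u. constant_solution N \<alpha> f d u \<and> finite_energy N u"
proof (rule ex_ex1I)
  show "\<exists>u. constant_solution N \<alpha> f d u \<and> finite_energy N u"
    using ex_geometric geometric_constant_solution geometric_finite_energy assms by blast
next
  fix u v
  assume u: "constant_solution N \<alpha> f d u \<and> finite_energy N u"
    and v: "constant_solution N \<alpha> f d v \<and> finite_energy N v"
  show "u = v"
  proof (rule extensionalityI)
    show "u \<in> extensional (words N)" "v \<in> extensional (words N)"
      using u v by (auto simp: constant_solution_def PiE_def)
    show "u j = v j" if "j \<in> words N" for j
      using geometric_unique[OF _ _ that] solution_geometric u v by blast
  qed
qed

end

section \<open>The structure exponents\<close>

context positive_family
begin

text \<open>The closed formula before the minimum with \<open>p\<close> is taken.\<close>

definition zeta :: "real \<Rightarrow> real" where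
  "zeta p = p / 3 + p / 2 * (L (3 / 2) - L (p / 2))"

text \<open>An affine function minus \<open>log 2 (S (p / 2))\<close>, so convexity, growth and
  asymptotics of the power sums carry over.\<close>

lemma zeta_eq: "zeta p = p * (1 / 3 + L (3 / 2) / 2) + log 2 (real (card A)) - log 2 (S (p / 2))"
  by (simp add: zeta_def log_S_eq algebra_simps)

lemma zeta_strictly_concave:
  assumes "\<not> (\<forall>w\<in>A. \<forall>w'\<in>A. x w = x w')"
  shows "strictly_concave_on {0..} zeta"
  unfolding strictly_concave_on_def
proof (intro conjI ballI impI)
  fix a b t :: real assume "t \<in> {0<..<1}" "a \<noteq> b"
  then have "log 2 (S (((1 - t) * a + t * b) / 2)) < (1 - t) * log 2 (S (a / 2)) + t * log 2 (S (b / 2))"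
    using log_S_strict_convex[OF assms, of "a / 2" "b / 2" t] by (simp add: add_divide_distrib)
  moreover define K c where "K = 1 / 3 + L (3 / 2) / 2" and "c = log 2 (real (card A))"
  ultimately show "(1 - t) * zeta a + t * zeta b < zeta ((1 - t) * a + t * b)"
    unfolding zeta_eq K_def[symmetric] c_def[symmetric] by (simp add: algebra_simps)
qed simp

text \<open>Since \<open>L 0 <= L (p / 2)\<close>, the second summand is at most
  \<open>p / 2 * (4 / 3)\<close>. This is when the minimum in the structure exponent is
  inactive.\<close>

lemma zeta_le:
  assumes "0 \<le> p" "L (3 / 2) - L 0 \<le> 4 / 3"
  shows "zeta p \<le> p"
proof -
  have "L 0 \<le> L (p / 2)" using L_mono assms(1) by (simp add: monoD)
  then have "p / 2 * (L (3 / 2) - L (p / 2)) \<le> p / 2 * (4 / 3)"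
    using assms by (intro mult_left_mono) auto
  then show ?thesis by (simp add: zeta_def)
qed

section \<open>Slope, monotonicity and the oblique asymptote\<close>

definition peak :: real where
  "peak = M powr (3 / 2) / (S (3 / 2) / real (card A))"

lemma peak_pos: "0 < peak"
  using M_pos S_pos card_pos by (simp add: peak_def)

lemma log_peak: "log 2 peak = 3 / 2 * (log 2 M - L (3 / 2))"
  using M_pos S_pos[of "3 / 2"] card_pos log_S_eq[of "3 / 2"]
  by (simp add: peak_def log_divide log_mult log_powr)

lemma peak_ge_one: "1 \<le> peak"
proof -
  have "S (3 / 2) \<le> M powr (3 / 2) * real (card A)"
    using S_growth_le[of 0 "3 / 2"] by (simp add: S_zero)
  then show ?thesis using S_pos[of "3 / 2"] by (simp add: peak_def)
qed

text \<open>The slope of the asymptote of \<open>zeta\<close>, and also a lower bound for all its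
  difference quotients. In this form its sign is decided by comparing \<open>peak\<close> with
  2.\<close>

definition slope :: real where
  "slope = (1 - log 2 peak) / 3"

lemma slope_eq: "slope = 1 / 3 + L (3 / 2) / 2 - log 2 M / 2"
  by (simp add: slope_def log_peak field_simps)

lemma slope_less_one: "slope < 1"
proof -
  have "log 2 1 \<le> log 2 peak" using peak_ge_one peak_pos by (subst log_le_cancel_iff) auto
  then show ?thesis by (simp add: slope_def)
qed

lemma slope_pos_iff: "0 < slope \<longleftrightarrow> peak < 2"
  using peak_pos by (simp add: slope_def log_less_iff)

lemma slope_eq_0_iff: "slope = 0 \<longleftrightarrow> peak = 2"
proof
  assume "slope = 0"
  then have "log 2 peak = 1" by (simp add: slope_def)
  then have "2 powr 1 = peak" using peak_pos powr_eq_iff[of peak 2 1] by simp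
  then show "peak = 2" by simp
qed (simp add: slope_def)

text \<open>The slope of \<open>log 2 (S s)\<close> never exceeds \<open>log 2 M\<close>, its
  limiting value.\<close>

lemma zeta_growth_ge: "p \<le> q \<Longrightarrow> slope * (q - p) \<le> zeta q - zeta p"
  using log_S_growth_le[of "p / 2" "q / 2"] unfolding zeta_eq slope_eq
  by (simp add: field_simps)

lemma zeta_strict_mono:
  assumes "peak < 2" "p < q"
  shows "zeta p < zeta q"
proof -
  have "0 < slope * (q - p)" using assms slope_pos_iff by simp
  then show ?thesis using zeta_growth_ge[of p q] assms(2) by simp
qed

text \<open>The asymptote of the power sums is rewritten for \<open>zeta\<close>. Because its slope
  is below 1, \<open>zeta p <= p\<close> for large \<open>p\<close>, so the truncated function has
  the same asymptote.\<close>

lemma zeta_asymptote: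
  obtains b where "((\<lambda>p. zeta p - (slope * p + b)) \<longlongrightarrow> 0) at_top"
    "((\<lambda>p. min p (zeta p) - (slope * p + b)) \<longlongrightarrow> 0) at_top"
proof
  define m where "m = real (card {w \<in> A. x w = M})"
  \<comment> \<open>\<open>m\<close> is the multiplicity of the maximum.\<close>
  define b where "b = log 2 (real (card A)) - log 2 m"
  have "filterlim (\<lambda>p::real. p / 2) at_top at_top" by real_asymp
  from filterlim_compose[OF log_S_asymptote this]
  have "((\<lambda>p. - (log 2 (S (p / 2)) - (p / 2 * log 2 M + log 2 m))) \<longlongrightarrow> - 0) at_top"
    unfolding m_def by (rule tendsto_minus)
  moreover have "- (log 2 (S (p / 2)) - (p / 2 * log 2 M + log 2 m)) = zeta p - (slope * p + b)" for p
    unfolding zeta_eq slope_eq b_def by (simp add: algebra_simps)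
  ultimately show lim: "((\<lambda>p. zeta p - (slope * p + b)) \<longlongrightarrow> 0) at_top"
    by simp
  have "\<forall>\<^sub>F p in at_top. zeta p - (slope * p + b) < 1"
    using order_tendstoD(2)[OF lim, of 1] by simp
  \<comment> \<open>Beyond this point the line raised by 1 lies below \<open>p\<close>.\<close>
  moreover have "\<forall>\<^sub>F p in at_top. (1 + b) / (1 - slope) \<le> p"
    by (rule eventually_ge_at_top)
  ultimately have "\<forall>\<^sub>F p in at_top. zeta p - (slope * p + b) = min p (zeta p) - (slope * p + b)"
  proof eventually_elim
    case (elim p)
    then have "1 + b \<le> p * (1 - slope)"
      using slope_less_one by (simp add: divide_le_eq)
    then have "zeta p \<le> p" using elim(1) by (simp add: algebra_simps)
    then show ?case by simp
  qed
  with lim show "((\<lambda>p. min p (zeta p) - (slope * p + b)) \<longlongrightarrow> 0) at_top"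
    by (rule Lim_transform_eventually)
qed

end

lemma (in repeated_tree) structure_exponent_eq_zeta:
  assumes "\<alpha> = 5 / 2" "N = 8" and sol: "constant_solution N \<alpha> f d u" "finite_energy N u"
  shows "structure_exponent 3 N u p = ereal (min p (zeta p))"
proof -
  \<comment> \<open>With these parameters the coefficient of \<open>p\<close> is
    \<open>- 3 / 2 + (5 / 2 + 3) / 3 = 1 / 3\<close>, plus the term in
    \<open>L (3 / 2)\<close>.\<close>
  have "log 2 (8::real) = 3" using log_pow_cancel[of "2::real" 3] by simp
  then have "real 3 - p / 2 * real 3 - p * log 2 ratio - log 2 (S (p / 2)) = zeta p"
    unfolding zeta_eq log_ratio using log_S_eq[of "3 / 2"] assms(1,2)
    by (simp add: card_Omega field_simps)
  then show ?thesis
    using geometric_structure_exponent[OF solution_geometric[OF sol], of 3 p] by simp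
qed

text \<open>The minimum in the definition of the exponents is kept: \<open>g\<close> is exact under
  the condition on \<open>ell\<close>, which says that \<open>g\<close> has slope at most 1 at 0,
  and otherwise after truncation at \<open>p\<close>. For \<open>r = 2\<close> the asymptote is
  horizontal.\<close>

theorem theorem1p1:
  fixes dm N :: nat and \<alpha> f :: real
    and d :: "nat list \<Rightarrow> real" and \<Omega> :: "'w set" and \<delta> :: "'w \<Rightarrow> real"
  assumes "dm = 3" and "N = 2 ^ dm" and "\<alpha> = 5 / 2" and "f > 0"
    and "\<forall>j\<in>words N. d j > 0" and "d [] = 1"
    and "repeated_coefficients N d \<Omega> \<delta>"
  shows
    "(\<exists>!u. constant_solution N \<alpha> f d u \<and> finite_energy N u) \<and>
     ((\<forall>\<omega>\<in>\<Omega>. \<forall>\<omega>'\<in>\<Omega>. \<delta> \<omega> = \<delta> \<omega>') \<longrightarrow> (\<exists>c. \<forall>s. ell \<Omega> \<delta> s = c)) \<and>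
     (\<not> (\<forall>\<omega>\<in>\<Omega>. \<forall>\<omega>'\<in>\<Omega>. \<delta> \<omega> = \<delta> \<omega>') \<longrightarrow>
        strict_mono (ell \<Omega> \<delta>) \<and>
        (\<exists>a. (ell \<Omega> \<delta> \<longlongrightarrow> a) at_top) \<and> (\<exists>b. (ell \<Omega> \<delta> \<longlongrightarrow> b) at_bot)) \<and>
     (\<forall>u. constant_solution N \<alpha> f d u \<and> finite_energy N u \<longrightarrow>
       (let \<zeta> = (\<lambda>p. real_of_ereal (structure_exponent dm N u p));
            g = (\<lambda>p. p / 3 + p / 2 * (ell \<Omega> \<delta> (3 / 2) - ell \<Omega> \<delta> (p / 2)));
            r = Max ((\<lambda>\<omega>. \<delta> \<omega> powr (3 / 2)) ` \<Omega>)
                  / ((\<Sum>\<omega>\<in>\<Omega>. \<delta> \<omega> powr (3 / 2)) / real N)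
        in
          (\<forall>p\<ge>0. structure_exponent dm N u p = ereal (min p (g p))) \<and>
          (ell \<Omega> \<delta> (3 / 2) - ell \<Omega> \<delta> 0 \<le> 4 / 3 \<longrightarrow>
             (\<forall>p\<ge>0. structure_exponent dm N u p = ereal (g p))) \<and>
          (\<not> (\<forall>\<omega>\<in>\<Omega>. \<forall>\<omega>'\<in>\<Omega>. \<delta> \<omega> = \<delta> \<omega>') \<longrightarrow>
             strictly_concave_on {0..} g \<and>
             (ell \<Omega> \<delta> (3 / 2) - ell \<Omega> \<delta> 0 \<le> 4 / 3 \<longrightarrow> strictly_concave_on {0..} \<zeta>) \<and>
             (\<exists>a b. (r \<noteq> 2 \<longrightarrow> a \<noteq> 0) \<and>
                ((\<lambda>p. g p - (a * p + b)) \<longlongrightarrow> 0) at_top \<and>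
                ((\<lambda>p. \<zeta> p - (a * p + b)) \<longlongrightarrow> 0) at_top)) \<and>
          (r < 2 \<longrightarrow> strict_mono_on {0..} g \<and> strict_mono_on {0..} \<zeta>)))"
proof -
  have N: "N = 8" and dm: "dm = 3" using assms by simp_all
  interpret repeated_tree N d \<Omega> \<delta> \<alpha> f
    using assms by unfold_locales auto
  \<comment> \<open>This is \<open>8 < 32\<close>.\<close>
  have "real N < 2 powr (2 * \<alpha>)"
    using powr_realpow[of "2::real" 5] by (simp add: N \<open>\<alpha> = 5 / 2\<close>)
  then have unique: "\<exists>!u. constant_solution N \<alpha> f d u \<and> finite_energy N u"
    by (rule ex1_solution)
  have g: "(\<lambda>p. p / 3 + p / 2 * (L (3 / 2) - L (p / 2))) = zeta"
    by (simp add: zeta_def fun_eq_iff)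
  have r: "Max ((\<lambda>\<omega>. \<delta> \<omega> powr (3 / 2)) ` \<Omega>) / ((\<Sum>\<omega>\<in>\<Omega>. \<delta> \<omega> powr (3 / 2)) / real N) = peak"
    by (simp add: peak_def Max_powr_eq power_sum_def card_Omega)
  obtain b where b: "((\<lambda>p. zeta p - (slope * p + b)) \<longlongrightarrow> 0) at_top"
    "((\<lambda>p. min p (zeta p) - (slope * p + b)) \<longlongrightarrow> 0) at_top"
    by (rule zeta_asymptote)
  have solution: "let \<zeta> = (\<lambda>p. real_of_ereal (structure_exponent dm N u p)); g = zeta; r = peak in
      (\<forall>p\<ge>0. structure_exponent dm N u p = ereal (min p (g p))) \<and>
      (L (3 / 2) - L 0 \<le> 4 / 3 \<longrightarrow> (\<forall>p\<ge>0. structure_exponent dm N u p = ereal (g p))) \<and>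
      (\<not> (\<forall>\<omega>\<in>\<Omega>. \<forall>\<omega>'\<in>\<Omega>. \<delta> \<omega> = \<delta> \<omega>') \<longrightarrow>
         strictly_concave_on {0..} g \<and>
         (L (3 / 2) - L 0 \<le> 4 / 3 \<longrightarrow> strictly_concave_on {0..} \<zeta>) \<and>
         (\<exists>a b. (r \<noteq> 2 \<longrightarrow> a \<noteq> 0) \<and>
            ((\<lambda>p. g p - (a * p + b)) \<longlongrightarrow> 0) at_top \<and>
            ((\<lambda>p. \<zeta> p - (a * p + b)) \<longlongrightarrow> 0) at_top)) \<and>
      (r < 2 \<longrightarrow> strict_mono_on {0..} g \<and> strict_mono_on {0..} \<zeta>)"
    if u: "constant_solution N \<alpha> f d u \<and> finite_energy N u" for u
  proof -
    have se: "structure_exponent dm N u p = ereal (min p (zeta p))" for p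
      using structure_exponent_eq_zeta[OF \<open>\<alpha> = 5 / 2\<close> N, of u p] u dm by simp
    have "strictly_concave_on {0..} (\<lambda>p. min p (zeta p))"
      if "L (3 / 2) - L 0 \<le> 4 / 3" "strictly_concave_on {0..} zeta"
    proof -
      have "min p (zeta p) = zeta p" if "0 \<le> p" for p
        using zeta_le[OF that \<open>L (3 / 2) - L 0 \<le> 4 / 3\<close>] by simp
      then show ?thesis
        using that(2) by (simp add: strictly_concave_on_def)
    qed
    \<comment> \<open>A minimum of two strictly increasing functions is strictly increasing.\<close>
    moreover have "min p (zeta p) < min q (zeta q)" if "peak < 2" "p < q" for p q
      using zeta_strict_mono[OF that] that(2) by linarith
    ultimately show ?thesis
      unfolding Let_def se real_of_ereal.simps
      using zeta_strictly_concave zeta_le slope_eq_0_iff b zeta_strict_mono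
      by (intro conjI impI allI exI[of _ slope] exI[of _ b] strict_mono_onI) auto
  qed
  show ?thesis
    unfolding g r
  proof (intro conjI impI allI)
    show "\<exists>c. \<forall>s. ell \<Omega> \<delta> s = c" if "\<forall>\<omega>\<in>\<Omega>. \<forall>\<omega>'\<in>\<Omega>. \<delta> \<omega> = \<delta> \<omega>'"
      using L_const[OF that] by blast
    show "\<exists>a. (ell \<Omega> \<delta> \<longlongrightarrow> a) at_top" using L_at_top by blast
    show "\<exists>b. (ell \<Omega> \<delta> \<longlongrightarrow> b) at_bot" by (rule L_at_bot)
  qed (rule unique L_strict_mono solution; assumption)+
qed

end
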